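(* Let $S\subseteq\mathbb{N}^d$ be a simplicial, fully embedded affine semigroup with generators $\mathbf{a}_1,\dots,\mathbf{a}_{d+r}$ and extremal rays $\mathbf{a}_1,\dots,\mathbf{a}_d$, let $E=\{\mathbf{a}_1,\dots,\mathbf{a}_d\}$, and let $\mathbb{K}$ be a field. Assume that $\mathbb{K}[S]$ is Cohen-Macaulay and let $\max_{\preceq_S}\mathrm{Ap}(S,E)=\{\mathbf{m}_1,\dots,\mathbf{m}_t\}$. Then $S$ is nearly Gorenstein if and only if for each $i=1,\dots,d+r$ there exists $\mathbf{m}\in\max_{\preceq_S}\mathrm{Ap}(S,E)$ such that $\mathbf{a}_i+\mathbf{m}-\mathbf{m}_j\in S$ for each $j=1,\dots,t$.
   Context: Setting: $\mathbb{N}$ contains $0$. $S\subseteq\mathbb{N}^d$ ($d\ge 1$) is an affine semigroup minimally generated by $\mathbf{a}_1,\dots,\mathbf{a}_{d+r}$, simplicial and fully embedded in $\mathbb{N}^d$ with extremal rays $\mathbf{a}_1,\dots,\mathbf{a}_d$: the vectors $\mathbf{a}_1,\dots,\mathbf{a}_d$ are linearly independent and $S\subseteq\sum_{i=1}^d\mathbb{Q}_{\ge0}\mathbf{a}_i$. Moreover each $\mathbf{a}_i$ ($1\le i\le d$) is the smallest generator on its extremal ray: if another generator $\mathbf{a}_j=q\mathbf{a}_i$ with $0\neq q\in\mathbb{Q}$, then $q>1$. $\mathbb{K}[S]=\mathbb{K}[\mathbf{x}^{\mathbf{a}}:\mathbf{a}\in S]$ is the semigroup ring; $\mathrm{group}(S)=\{\mathbf{a}-\mathbf{b}:\mathbf{a},\mathbf{b}\in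 S\}$; $M=S\setminus\{\mathbf{0}\}$. $\mathrm{Ap}(S,E)=\{\mathbf{a}\in S : \mathbf{a}-\mathbf{a}_i\notin S \text{ for all } i=1,\dots,d\}$, and $\mathbf{b}\preceq_S\mathbf{a}$ iff $\mathbf{a}-\mathbf{b}\in S$. $\mathrm{QF}(S)=\{\mathbf{m}-\sum_{i=1}^d\mathbf{a}_i : \mathbf{m}\in\max_{\preceq_S}\mathrm{Ap}(S,E)\}$, $\omega_S=\{-\mathbf{f}:\mathbf{f}\in\mathrm{QF}(S)\}+S$, and $\omega_S^{-1}=\{\mathbf{z}\in\mathrm{group}(S): \mathbf{z}+\omega_S\subseteq S\}$. The trace of $S$ is $\mathrm{tr}(S)=\omega_S+\omega_S^{-1}$, the set of exponents of the monomials in the trace ideal of the canonical module of $\mathbb{K}[S]$ (when $\mathbb{K}[S]$ is Cohen-Macaulay). $S$ is nearly Gorenstein if $\mathbb{K}[S]$ is Cohen-Macaulay and $M\subseteq\mathrm{tr}(S)$; equivalently, the trace ideal of the canonical module of $\mathbb{K}[S]$ contains the monomial maximal ideal. *)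

theory Defs
  imports
    "HOL-Analysis.Cartesian_Space"
    "HOL-Algebra.Ring_Divisibility"
    "HOL-Library.Poly_Mapping"
    "HOL-Library.Extended_Nat"
begin

section \<open>Cohen-Macaulay rings\<close>

definition krull_dim :: "('a, 'b) ring_scheme \<Rightarrow> enat" where
  "krull_dim R = Sup {enat n | n. \<exists>P. (\<forall>i\<le>n. primeideal (P i) R) \<and> (\<forall>i<n. P i \<subset> P (Suc i))}"

text \<open>\<open>x\<^sub>i\<close> is a nonzerodivisor on \<open>R / (x\<^sub>1, \<dots>, x\<^sub>i\<^sub>-\<^sub>1)\<close>, spelled out in \<open>R\<close> itself.\<close>

definition regular_sequence :: "('a, 'b) ring_scheme \<Rightarrow> 'a list \<Rightarrow> bool" where
  "regular_sequence R xs \<longleftrightarrow>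
     set xs \<subseteq> carrier R \<and>
     (\<forall>i<length xs. \<forall>y\<in>carrier R.
        xs ! i \<otimes>\<^bsub>R\<^esub> y \<in> Idl\<^bsub>R\<^esub> (set (take i xs)) \<longrightarrow> y \<in> Idl\<^bsub>R\<^esub> (set (take i xs))) \<and>
     Idl\<^bsub>R\<^esub> (set xs) \<noteq> carrier R"

definition grade :: "('a, 'b) ring_scheme \<Rightarrow> 'a set \<Rightarrow> enat" where
  "grade R I = Sup {enat (length xs) | xs. regular_sequence R xs \<and> set xs \<subseteq> I}"

text \<open>A Noetherian local ring whose depth, the grade of its maximal ideal, is its dimension.\<close>

definition cohen_macaulay_local :: "('a, 'b) ring_scheme \<Rightarrow> bool" where
  "cohen_macaulay_local R \<longleftrightarrow>
     cring R \<and> noetherian_ring R \<and>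
     (\<exists>m. {I. maximalideal I R} = {m} \<and> grade R m = krull_dim R)"

text \<open>The localization \<open>R\<^sub>P\<close>: the class of \<open>(r, s)\<close> with \<open>s \<notin> P\<close> is the fraction \<open>r / s\<close>.\<close>

definition fraction_rel :: "('a, 'b) ring_scheme \<Rightarrow> 'a set \<Rightarrow> (('a \<times> 'a) \<times> ('a \<times> 'a)) set" where
  "fraction_rel R P =
     {((r, s), (r', s')).
        r \<in> carrier R \<and> s \<in> carrier R - P \<and> r' \<in> carrier R \<and> s' \<in> carrier R - P \<and>
        (\<exists>u\<in>carrier R - P. u \<otimes>\<^bsub>R\<^esub> (r \<otimes>\<^bsub>R\<^esub> s') = u \<otimes>\<^bsub>R\<^esub> (r' \<otimes>\<^bsub>R\<^esub> s))}"

definition fraction :: "('a, 'b) ring_scheme \<Rightarrow> 'a set \<Rightarrow> 'a \<Rightarrow> 'a \<Rightarrow> ('a \<times> 'a) set" where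
  "fraction R P r s = fraction_rel R P `` {(r, s)}"

definition localization :: "('a, 'b) ring_scheme \<Rightarrow> 'a set \<Rightarrow> ('a \<times> 'a) set ring" where
  "localization R P =
     \<lparr>carrier = (carrier R \<times> (carrier R - P)) // fraction_rel R P,
      monoid.mult = (\<lambda>X Y. \<Union>(r, s)\<in>X. \<Union>(r', s')\<in>Y. fraction R P (r \<otimes>\<^bsub>R\<^esub> r') (s \<otimes>\<^bsub>R\<^esub> s')),
      one = fraction R P \<one>\<^bsub>R\<^esub> \<one>\<^bsub>R\<^esub>,
      zero = fraction R P \<zero>\<^bsub>R\<^esub> \<one>\<^bsub>R\<^esub>,
      add = (\<lambda>X Y. \<Union>(r, s)\<in>X. \<Union>(r', s')\<in>Y.
               fraction R P (r \<otimes>\<^bsub>R\<^esub> s' \<oplus>\<^bsub>R\<^esub> r' \<otimes>\<^bsub>R\<^esub> s) (s \<otimes>\<^bsub>R\<^esub> s'))\<rparr>"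

definition cohen_macaulay :: "('a, 'b) ring_scheme \<Rightarrow> bool" where
  "cohen_macaulay R \<longleftrightarrow>
     cring R \<and> noetherian_ring R \<and>
     (\<forall>P. maximalideal P R \<longrightarrow> cohen_macaulay_local (localization R P))"

section \<open>Affine semigroups\<close>

text \<open>
  Semigroups in \<open>\<nat>\<^sup>d\<close>, where \<open>d\<close> is the cardinality of the index type, are sets of integer
  vectors with nonnegative entries, so that differences can be formed in \<open>\<int>\<^sup>d\<close>.
\<close>

definition rat_vec :: "int ^ 'd \<Rightarrow> rat ^ 'd" where
  "rat_vec v = (\<chi> k. of_int (v $ k))"

definition generated_by :: "(nat \<Rightarrow> int ^ 'd) \<Rightarrow> nat set \<Rightarrow> (int ^ 'd) set" where
  "generated_by a I = {\<Sum>i\<in>I. int (n i) *s a i | n. True}"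

definition minimally_generated_by :: "(int ^ 'd) set \<Rightarrow> (nat \<Rightarrow> int ^ 'd) \<Rightarrow> nat set \<Rightarrow> bool" where
  "minimally_generated_by S a I \<longleftrightarrow> S = generated_by a I \<and> (\<forall>J. J \<subset> I \<longrightarrow> generated_by a J \<noteq> S)"

text \<open>
  The generators are \<open>a 1, \<dots>, a (d + r)\<close>; the first \<open>d\<close> of them are the extremal rays, each
  being the smallest generator on its ray.
\<close>

definition simplicial_fully_embedded ::
  "(int ^ 'd::finite) set \<Rightarrow> (nat \<Rightarrow> int ^ 'd) \<Rightarrow> nat \<Rightarrow> bool" where
  "simplicial_fully_embedded S a r \<longleftrightarrow>
     (\<forall>s\<in>S. \<forall>k. 0 \<le> s $ k) \<and>
     minimally_generated_by S a {1..CARD('d) + r} \<and>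
     inj_on a {1..CARD('d)} \<and>
     vec.independent (rat_vec ` a ` {1..CARD('d)}) \<and>
     (\<forall>s\<in>S. \<exists>c. (\<forall>i\<in>{1..CARD('d)}. 0 \<le> c i) \<and>
        rat_vec s = (\<Sum>i\<in>{1..CARD('d)}. c i *s rat_vec (a i))) \<and>
     (\<forall>i\<in>{1..CARD('d)}. \<forall>j\<in>{1..CARD('d) + r} - {i}. \<forall>q.
        q \<noteq> 0 \<and> rat_vec (a j) = q *s rat_vec (a i) \<longrightarrow> 1 < q)"

text \<open>\<open>\<bbbK>[S]\<close>, the element \<open>f\<close> stands for the sum of the terms \<open>lookup f s \<cdot> x\<^sup>s\<close>.\<close>

definition semigroup_ring :: "'a::comm_monoid_add set \<Rightarrow> ('a \<Rightarrow>\<^sub>0 'k::field) ring" where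
  "semigroup_ring S =
     \<lparr>carrier = {f. Poly_Mapping.keys f \<subseteq> S}, monoid.mult = (*), one = 1, zero = 0, add = (+)\<rparr>"

definition group_of :: "'v::ab_group_add set \<Rightarrow> 'v set" where
  "group_of S = {a - b | a b. a \<in> S \<and> b \<in> S}"

definition apery :: "'v::ab_group_add set \<Rightarrow> 'v set \<Rightarrow> 'v set" where
  "apery S E = {a \<in> S. \<forall>e\<in>E. a - e \<notin> S}"

definition semigroup_le :: "'v::ab_group_add set \<Rightarrow> 'v \<Rightarrow> 'v \<Rightarrow> bool" where
  "semigroup_le S b a \<longleftrightarrow> a - b \<in> S"

definition maximal_elements :: "'v::ab_group_add set \<Rightarrow> 'v set \<Rightarrow> 'v set" where
  "maximal_elements S A = {m \<in> A. \<forall>a\<in>A. semigroup_le S m a \<longrightarrow> a = m}"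

definition quasi_frobenius :: "'v::ab_group_add set \<Rightarrow> 'v set \<Rightarrow> 'v set" where
  "quasi_frobenius S E = {m - \<Sum>E | m. m \<in> maximal_elements S (apery S E)}"

definition canonical_set :: "'v::ab_group_add set \<Rightarrow> 'v set \<Rightarrow> 'v set" where
  "canonical_set S E = {- f + s | f s. f \<in> quasi_frobenius S E \<and> s \<in> S}"

definition canonical_inverse :: "'v::ab_group_add set \<Rightarrow> 'v set \<Rightarrow> 'v set" where
  "canonical_inverse S E = {z \<in> group_of S. \<forall>w\<in>canonical_set S E. z + w \<in> S}"

definition semigroup_trace :: "'v::ab_group_add set \<Rightarrow> 'v set \<Rightarrow> 'v set" where
  "semigroup_trace S E = {w + z | w z. w \<in> canonical_set S E \<and> z \<in> canonical_inverse S E}"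

definition nearly_gorenstein :: "'k::field itself \<Rightarrow> 'v::ab_group_add set \<Rightarrow> 'v set \<Rightarrow> bool" where
  "nearly_gorenstein K S E \<longleftrightarrow>
     cohen_macaulay (semigroup_ring S :: ('v \<Rightarrow>\<^sub>0 'k) ring) \<and> S - {0} \<subseteq> semigroup_trace S E"

end

theory Submission
  imports Defs
begin

text \<open>
  The translation by the sum of the extremal rays that separates \<open>m\<close> from the quasi-Frobenius
  element \<open>m - \<Sum>E\<close> enters \<open>\<omega>\<close> and \<open>\<omega>\<inverse>\<close> with opposite signs, so it cancels in the trace
  \<open>\<omega> + \<omega>\<inverse>\<close>. As \<open>\<omega>\<close> is generated over \<open>S\<close> by the elements \<open>\<Sum>E - m'\<close> with \<open>m'\<close> maximal in
  the Apery set, and \<open>\<omega>\<inverse>\<close> absorbs addition of elements of \<open>S\<close>, an element \<open>x\<close> of \<open>S\<close> lies in the trace iff \<open>x = (\<Sum>E - m') + z\<close> with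
  \<open>z \<in> \<omega>\<inverse>\<close> for one such \<open>m'\<close>; and \<open>z = x + m' - \<Sum>E\<close> carries \<open>\<omega>\<close> into \<open>S\<close> iff it carries
  each of these generators into \<open>S\<close>, that is, iff \<open>x + m' - m \<in> S\<close> for all maximal \<open>m\<close>. This
  is \<open>semigroup_trace_iff\<close>, which makes the condition of the theorem say that every generator
  of \<open>S\<close> lies in the trace.

  The trace absorbs addition of elements of \<open>S\<close>, so it contains all nonzero elements of \<open>S\<close> as
  soon as it contains the generators. Conversely, the generators are nonzero elements of \<open>S\<close>
  because the generating system is minimal (\<open>minimal_generator_nonzero\<close>).
\<close>

lemma generated_by_zero: "0 \<in> generated_by a I"
  unfolding generated_by_def by (intro CollectI exI[of _ "\<lambda>_. 0"]) simp

lemma generated_by_add: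
  assumes "x \<in> generated_by a I" "y \<in> generated_by a I"
  shows "x + y \<in> generated_by a I"
proof -
  from assms obtain n n' where "x = (\<Sum>i\<in>I. int (n i) *s a i)" "y = (\<Sum>i\<in>I. int (n' i) *s a i)"
    unfolding generated_by_def by blast
  then have "x + y = (\<Sum>i\<in>I. int (n i + n' i) *s a i)"
    by (simp add: sum.distrib vector_sadd_rdistrib)
  then show ?thesis
    unfolding generated_by_def by (intro CollectI exI[of _ "\<lambda>i. n i + n' i"]) simp
qed

lemma generator_in_generated_by:
  assumes "finite I" "i \<in> I"
  shows "a i \<in> generated_by a I"
proof -
  have "(\<Sum>k\<in>I. int (if k = i then 1 else 0) *s a k) = (\<Sum>k\<in>I. if k = i then a k else 0)"
    by (rule sum.cong) auto
  also have "\<dots> = a i" using assms by simp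
  finally have "a i = (\<Sum>k\<in>I. int (if k = i then 1 else 0) *s a k)" by (rule sym)
  then show ?thesis unfolding generated_by_def by (intro CollectI exI) simp
qed

lemma generated_by_nonzero_split:
  assumes "finite I" "x \<in> generated_by a I" "x \<noteq> 0"
  obtains i y where "i \<in> I" "y \<in> generated_by a I" "x = a i + y"
proof -
  from assms(2) obtain n where x: "x = (\<Sum>k\<in>I. int (n k) *s a k)"
    unfolding generated_by_def by blast
  with assms(3) obtain i where i: "i \<in> I" "int (n i) *s a i \<noteq> 0"
    by (meson sum.not_neutral_contains_not_neutral)
  then have "n i \<noteq> 0" by auto
  then have ni: "n i = Suc (n i - 1)" by simp
  let ?y = "\<Sum>k\<in>I. int ((n(i := n i - 1)) k) *s a k"
  have "int (n i) *s a i = a i + int (n i - 1) *s a i"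
    by (subst ni) (simp only: of_nat_Suc vector_sadd_rdistrib vector_smult_lid)
  moreover have "(\<Sum>k\<in>I - {i}. int (n k) *s a k) =
      (\<Sum>k\<in>I - {i}. int ((n(i := n i - 1)) k) *s a k)"
    by (rule sum.cong) auto
  ultimately have "x = a i + ?y"
    unfolding x by (simp add: sum.remove[OF assms(1) i(1)])
  moreover have "?y \<in> generated_by a I" unfolding generated_by_def by blast
  ultimately show ?thesis using that i(1) by blast
qed

text \<open>A zero generator could be dropped without changing the generated semigroup.\<close>

lemma minimal_generator_nonzero:
  assumes "minimally_generated_by S a I" "finite I" "i \<in> I"
  shows "a i \<noteq> 0"
proof
  assume "a i = 0"
  then have "(\<Sum>k\<in>I. int (n k) *s a k) = (\<Sum>k\<in>I - {i}. int (n k) *s a k)" for n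
    by (simp add: sum.remove[OF assms(2,3)])
  then have "generated_by a (I - {i}) = generated_by a I"
    unfolding generated_by_def by simp
  with assms show False unfolding minimally_generated_by_def by blast
qed

text \<open>
  The hypothesis on \<open>\<Sum>E\<close> puts the candidate \<open>x + m' - \<Sum>E\<close> for an element of \<open>\<omega>\<inverse>\<close> into the
  group of \<open>S\<close>.
\<close>

lemma semigroup_trace_iff:
  fixes S E :: "'v::ab_group_add set"
  assumes zero: "0 \<in> S"
    and add: "\<And>x y. x \<in> S \<Longrightarrow> y \<in> S \<Longrightarrow> x + y \<in> S"
    and E: "\<Sum>E \<in> S"
    and x: "x \<in> S"
  shows "x \<in> semigroup_trace S E \<longleftrightarrow>
    (\<exists>m'\<in>maximal_elements S (apery S E). \<forall>m\<in>maximal_elements S (apery S E). x + m' - m \<in> S)"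
    (is "_ \<longleftrightarrow> (\<exists>m'\<in>?M. \<forall>m\<in>?M. _)")
proof
  assume "x \<in> semigroup_trace S E"
  then obtain m' s z where m': "m' \<in> ?M" and s: "s \<in> S" and z: "z \<in> canonical_inverse S E"
    and eq: "x = - (m' - \<Sum>E) + s + z"
    unfolding semigroup_trace_def canonical_set_def quasi_frobenius_def by blast
  have "x + m' - m \<in> S" if "m \<in> ?M" for m
  proof -
    have "- (m - \<Sum>E) + 0 \<in> canonical_set S E"
      unfolding canonical_set_def quasi_frobenius_def using that zero by blast
    then have "z + (- (m - \<Sum>E) + 0) \<in> S"
      using z unfolding canonical_inverse_def by blast
    from add[OF s this] show ?thesis by (simp add: eq algebra_simps)
  qed
  with m' show "\<exists>m'\<in>?M. \<forall>m\<in>?M. x + m' - m \<in> S" by blast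
next
  assume "\<exists>m'\<in>?M. \<forall>m\<in>?M. x + m' - m \<in> S"
  then obtain m' where m': "m' \<in> ?M" and le: "\<And>m. m \<in> ?M \<Longrightarrow> x + m' - m \<in> S" by blast
  let ?z = "x + m' - \<Sum>E"
  have "m' \<in> S" using m' by (simp add: maximal_elements_def apery_def)
  then have "?z \<in> group_of S" unfolding group_of_def using add[OF x] E by blast
  moreover have "?z + w \<in> S" if w: "w \<in> canonical_set S E" for w
  proof -
    from w obtain m s where m: "m \<in> ?M" and s: "s \<in> S" and eq: "w = - (m - \<Sum>E) + s"
      unfolding canonical_set_def quasi_frobenius_def by blast
    have "?z + w = x + m' - m + s" by (simp add: eq algebra_simps)
    with add[OF le[OF m] s] show ?thesis by (simp only:)
  qed
  ultimately have "?z \<in> canonical_inverse S E" unfolding canonical_inverse_def by blast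
  moreover have "- (m' - \<Sum>E) + 0 \<in> canonical_set S E"
    unfolding canonical_set_def quasi_frobenius_def using m' zero by blast
  moreover have "x = (- (m' - \<Sum>E) + 0) + ?z" by simp
  ultimately show "x \<in> semigroup_trace S E" unfolding semigroup_trace_def by blast
qed

lemma semigroup_trace_add:
  fixes S E :: "'v::ab_group_add set"
  assumes add: "\<And>x y. x \<in> S \<Longrightarrow> y \<in> S \<Longrightarrow> x + y \<in> S"
    and x: "x \<in> semigroup_trace S E" and s: "s \<in> S"
  shows "x + s \<in> semigroup_trace S E"
proof -
  from x obtain f u z where "f \<in> quasi_frobenius S E" "u \<in> S" "z \<in> canonical_inverse S E"
    and eq: "x = - f + u + z"
    unfolding semigroup_trace_def canonical_set_def by blast
  moreover from this have "- f + (u + s) \<in> canonical_set S E"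
    unfolding canonical_set_def using add s by blast
  moreover have "x + s = (- f + (u + s)) + z" by (simp add: eq algebra_simps)
  ultimately show ?thesis unfolding semigroup_trace_def by blast
qed

theorem corollary1p6:
  fixes S E :: "(int ^ 'd::finite) set"
    and a m :: "nat \<Rightarrow> int ^ 'd"
    and r t :: nat
  assumes "simplicial_fully_embedded S a r"
    and "E = a ` {1..CARD('d)}"
    and "cohen_macaulay (semigroup_ring S :: ((int ^ 'd) \<Rightarrow>\<^sub>0 'k::field) ring)"
    and "maximal_elements S (apery S E) = m ` {1..t}"
  shows "nearly_gorenstein TYPE('k) S E \<longleftrightarrow>
    (\<forall>i\<in>{1..CARD('d) + r}. \<exists>m'\<in>maximal_elements S (apery S E).
       \<forall>j\<in>{1..t}. a i + m' - m j \<in> S)"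
proof -
  let ?I = "{1..CARD('d) + r}"
  have min: "minimally_generated_by S a ?I"
    using assms(1) by (simp add: simplicial_fully_embedded_def)
  then have S: "S = generated_by a ?I" by (simp add: minimally_generated_by_def)
  have zero: "0 \<in> S" and add: "\<And>x y. x \<in> S \<Longrightarrow> y \<in> S \<Longrightarrow> x + y \<in> S"
    unfolding S by (rule generated_by_zero, rule generated_by_add)
  have gen: "a i \<in> S" if "i \<in> ?I" for i
    unfolding S using that by (intro generator_in_generated_by) auto
  have "E \<subseteq> S" using gen assms(2) by auto
  then have sumE: "\<Sum>E \<in> S"
    by (induction E rule: infinite_finite_induct) (auto simp: zero add)
  have "S - {0} \<subseteq> semigroup_trace S E \<longleftrightarrow> (\<forall>i\<in>?I. a i \<in> semigroup_trace S E)"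
  proof
    assume "S - {0} \<subseteq> semigroup_trace S E"
    then show "\<forall>i\<in>?I. a i \<in> semigroup_trace S E"
      using gen minimal_generator_nonzero[OF min] by blast
  next
    assume tr: "\<forall>i\<in>?I. a i \<in> semigroup_trace S E"
    show "S - {0} \<subseteq> semigroup_trace S E"
    proof
      fix x assume "x \<in> S - {0}"
      then have "x \<in> generated_by a ?I" "x \<noteq> 0" by (simp_all add: S)
      then obtain i y where i: "i \<in> ?I" and y: "y \<in> generated_by a ?I" and eq: "x = a i + y"
        by (rule generated_by_nonzero_split[OF finite_atLeastAtMost])
      have "a i + y \<in> semigroup_trace S E"
        using add tr[rule_format, OF i] y[folded S] by (rule semigroup_trace_add)
      then show "x \<in> semigroup_trace S E" by (simp only: eq)
    qed
  qed
  also have "\<dots> \<longleftrightarrow> (\<forall>i\<in>?I. \<exists>m'\<in>maximal_elements S (apery S E).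
       \<forall>j\<in>{1..t}. a i + m' - m j \<in> S)"
    using semigroup_trace_iff[OF zero add sumE gen] by (simp add: assms(4))
  finally show ?thesis using assms(3) by (simp add: nearly_gorenstein_def)
qed

end
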